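(* Let $k\ge 3$. Consider the $k$-dimensional Poisson regression model with first-order interactions on the design region $\mathcal{X}=\bigcup_{1\le i<j\le k}\mathcal{X}_{ij}$, where $\mathcal{X}_{ij}=\{(x_1,\dots,x_k): x_i,x_j\ge 0,\ x_\ell=0 \text{ for } \ell\ne i,j\}$. Let $\beta_0=0$, $\beta_1=\dots=\beta_k=-1$, $\rho_{ij}=-\beta_{ij}\ge 0$ for $1\le i<j\le k$, let $t_{ij}=(\sqrt{1+8\rho_{ij}}-1)/(2\rho_{ij})$ if $\rho_{ij}>0$ and $t_{ij}=2$ if $\rho_{ij}=0$, and let $\mathbf{x}_{ij}\in\mathcal{X}_{ij}$ be the point with $x_i=x_j=t_{ij}$. Let $\mathbf{x}_0=(0,\dots,0)$ and $\mathbf{x}_i=2\mathbf{e}_i$ for $i=1,\dots,k$ (where $\mathbf{e}_i$ is the $i$-th unit vector). Then the design which assigns equal weights $1/(1+k+k(k-1)/2)$ to the $1+k+k(k-1)/2$ settings $\mathbf{x}_0$, $\mathbf{x}_1,\dots,\mathbf{x}_k$ and $\mathbf{x}_{ij}$, $1\le i<j\le k$, is locally $D$-optimal at $\boldsymbol{\beta}$ on $\mathcal{X}$.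
   Context: In the $k$-dimensional Poisson regression model with first-order interactions, an observation at $\mathbf{x}=(x_1,\dots,x_k)$ is Poisson distributed with mean $\lambda(\mathbf{x})=\exp(\mathbf{f}(\mathbf{x})^\top\boldsymbol{\beta})$, where $\mathbf{f}(\mathbf{x})=(1,x_1,\dots,x_k,(x_ix_j)_{1\le i<j\le k})^\top$, so $\mathbf{f}(\mathbf{x})^\top\boldsymbol{\beta}=\beta_0+\sum_j\beta_jx_j+\sum_{i<j}\beta_{ij}x_ix_j$. A design $\xi$ on $\mathcal{X}$ is a finite collection of distinct settings $\mathbf{x}_i\in\mathcal{X}$ with weights $w_i\ge0$ summing to $1$; its information matrix is $\mathbf{M}_{\boldsymbol{\beta}}(\xi)=\sum_i w_i\lambda(\mathbf{x}_i)\mathbf{f}(\mathbf{x}_i)\mathbf{f}(\mathbf{x}_i)^\top$. A design is locally $D$-optimal at $\boldsymbol{\beta}$ on $\mathcal{X}$ if it maximizes $\det\mathbf{M}_{\boldsymbol{\beta}}(\xi)$ over all designs on $\mathcal{X}$. *)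

theory Defs
  imports Complex_Main "Jordan_Normal_Form.Determinant"
begin

(* Settings x in R^k are represented as functions nat => real, with coordinates
   x 0, ..., x (k-1) (paper's x_1..x_k); coordinates l >= k are required to be 0. *)

definition pairs :: "nat \<Rightarrow> (nat \<times> nat) list" where
  "pairs k = [(i,j). i \<leftarrow> [0..<k], j \<leftarrow> [Suc i..<k]]"

definition npar :: "nat \<Rightarrow> nat" where
  "npar k = 1 + k + length (pairs k)"

definition regf :: "nat \<Rightarrow> (nat \<Rightarrow> real) \<Rightarrow> real list" where
  "regf k x = 1 # map x [0..<k] @ map (\<lambda>(i,j). x i * x j) (pairs k)"

definition intensity :: "nat \<Rightarrow> real list \<Rightarrow> (nat \<Rightarrow> real) \<Rightarrow> real" where
  "intensity k beta x = exp (\<Sum>a<npar k. regf k x ! a * beta ! a)"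

definition info_mat :: "nat \<Rightarrow> real list \<Rightarrow> (nat \<Rightarrow> real) set \<Rightarrow> ((nat \<Rightarrow> real) \<Rightarrow> real) \<Rightarrow> real mat" where
  "info_mat k beta S w = mat (npar k) (npar k)
     (\<lambda>(a,b). \<Sum>x\<in>S. w x * intensity k beta x * (regf k x ! a) * (regf k x ! b))"

definition is_design :: "(nat \<Rightarrow> real) set \<Rightarrow> (nat \<Rightarrow> real) set \<Rightarrow> ((nat \<Rightarrow> real) \<Rightarrow> real) \<Rightarrow> bool" where
  "is_design X S w \<longleftrightarrow> finite S \<and> S \<noteq> {} \<and> S \<subseteq> X \<and> (\<forall>x\<in>S. w x \<ge> 0) \<and> (\<Sum>x\<in>S. w x) = 1"

definition locally_D_optimal :: "nat \<Rightarrow> real list \<Rightarrow> (nat \<Rightarrow> real) set \<Rightarrow> (nat \<Rightarrow> real) set \<Rightarrow> ((nat \<Rightarrow> real) \<Rightarrow> real) \<Rightarrow> bool" where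
  "locally_D_optimal k beta X S w \<longleftrightarrow> is_design X S w \<and>
     (\<forall>S' w'. is_design X S' w' \<longrightarrow> det (info_mat k beta S' w') \<le> det (info_mat k beta S w))"

definition Xij :: "nat \<Rightarrow> nat \<Rightarrow> (nat \<Rightarrow> real) set" where
  "Xij i j = {x. x i \<ge> 0 \<and> x j \<ge> 0 \<and> (\<forall>l. l \<noteq> i \<and> l \<noteq> j \<longrightarrow> x l = 0)}"

definition Xreg :: "nat \<Rightarrow> (nat \<Rightarrow> real) set" where
  "Xreg k = (\<Union>i<k. \<Union>j\<in>{Suc i..<k}. Xij i j)"

definition beta_of :: "nat \<Rightarrow> (nat \<Rightarrow> nat \<Rightarrow> real) \<Rightarrow> real list" where
  "beta_of k rho = 0 # replicate k (-1) @ map (\<lambda>(i,j). - rho i j) (pairs k)"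

definition tval :: "real \<Rightarrow> real" where
  "tval r = (if r > 0 then (sqrt (1 + 8 * r) - 1) / (2 * r) else 2)"

definition opt_support :: "nat \<Rightarrow> (nat \<Rightarrow> nat \<Rightarrow> real) \<Rightarrow> (nat \<Rightarrow> real) set" where
  "opt_support k rho =
     {\<lambda>_. 0} \<union> {(\<lambda>l. if l = i then 2 else 0) | i. i < k}
     \<union> {(\<lambda>l. if l = i \<or> l = j then tval (rho i j) else 0) | i j. i < j \<and> j < k}"

end

theory Submission
  imports Defs "HOL-Analysis.Convex"
begin

text \<open>
  The design is saturated, so the weighted regression vector \<open>sqrt (\<lambda> x) f(x)\<close> of any setting is a
  combination of those of the support points, with coefficient vector \<open>h(x)\<close>. If \<open>h(x)\<close> always
  lies in the unit ball, then the information matrix of any design is \<open>G\<^sup>T N G\<close>, where the rows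
  of \<open>G\<close> belong to the support points and \<open>N\<close> is positive semidefinite with trace at most 1;
  Hadamard's inequality and AM-GM give \<open>det N \<le> n\<^sup>-\<^sup>n\<close>, which is attained by equal weights.

  On a face \<open>Xij i j\<close> only four coefficients of \<open>h(x)\<close> are nonzero, and with \<open>x\<^sub>i = t a\<close>,
  \<open>x\<^sub>j = t b\<close>, \<open>\<rho> t\<^sup>2 = 2 - t\<close> the unit ball condition becomes an inequality between a quartic
  polynomial and \<open>exp (t (a + b) + (2 - t) a b)\<close>. On the level curves of the exponent the polynomial is
  convex in \<open>a b\<close>, which leaves the axes and the diagonal \<open>a = b\<close>.
\<close>

section \<open>The sensitivity bound on a face\<close>

text \<open>This is the bound at the axis point \<open>2 * u\<close>, with equality at
  \<open>u = 0\<close> and \<open>u = 1\<close>, the two support points of that axis. The quotient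
  \<open>g\<close> of the two sides falls on \<open>[0, r]\<close>, rises on \<open>[r, 1]\<close>
  and falls again, so its maximum is \<open>g 0 = g 1 = 1\<close>.\<close>

lemma quadratic_le_exp:
  fixes u :: real
  assumes "0 \<le> u"
  shows "(1 - u)\<^sup>2 + exp 2 * u\<^sup>2 \<le> exp (2 * u)"
proof -
  define g where "g v = exp (-2 * v) * ((1 - v)\<^sup>2 + exp 2 * v\<^sup>2)" for v :: real
  \<comment> \<open>The derivative of \<open>g\<close> vanishes only at 1 and at \<open>r\<close>,
    the zero of its last factor.\<close>
  define r :: real where "r = 2 / (1 + exp 2)"
  have e: "1 \<le> exp (2::real)" by simp
  have r: "0 < r" "r \<le> 1" using e by (auto simp: r_def field_simps add_pos_pos)
  have der: "(g has_real_derivative 2 * exp (-2 * v) * (1 - v) * ((1 + exp 2) * v - 2)) (at v)" for v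
    unfolding g_def by (auto intro!: derivative_eq_intros simp: power2_eq_square algebra_simps)
  have le: "(1 + exp 2) * v - 2 \<le> 0" if "v \<le> r" for v
    using that e by (simp add: r_def field_simps)
  have ge: "(1 + exp 2) * v - 2 \<ge> 0" if "r \<le> v" for v
    using that e by (simp add: r_def field_simps)
  have g01: "g 0 = 1" "g 1 = 1" by (auto simp: g_def simp flip: exp_add)
  have "g u \<le> 1"
  proof -
    consider "u \<le> r" | "r \<le> u" "u \<le> 1" | "1 \<le> u" by linarith
    then show ?thesis
    proof cases
      case 1
      have "g u \<le> g 0"
      proof (rule DERIV_nonpos_imp_nonincreasing[OF assms])
        fix v assume "0 \<le> v" "v \<le> u"
        then have "2 * exp (-2 * v) * (1 - v) * ((1 + exp 2) * v - 2) \<le> 0"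
          using le[of v] 1 r by (intro mult_nonneg_nonpos) auto
        then show "\<exists>y. (g has_real_derivative y) (at v) \<and> y \<le> 0" using der by blast
      qed
      then show ?thesis by (simp add: g01)
    next
      case 2
      have "g u \<le> g 1"
      proof (rule DERIV_nonneg_imp_nondecreasing[OF 2(2)])
        fix v assume "u \<le> v" "v \<le> 1"
        then have "2 * exp (-2 * v) * (1 - v) * ((1 + exp 2) * v - 2) \<ge> 0"
          using ge[of v] 2 by (intro mult_nonneg_nonneg) auto
        then show "\<exists>y. (g has_real_derivative y) (at v) \<and> y \<ge> 0" using der by blast
      qed
      then show ?thesis by (simp add: g01)
    next
      case 3
      have "g u \<le> g 1"
      proof (rule DERIV_nonpos_imp_nonincreasing[OF 3])
        fix v assume "1 \<le> v" "v \<le> u"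
        then have "2 * exp (-2 * v) * (1 - v) * ((1 + exp 2) * v - 2) \<le> 0"
          using ge[of v] r by (intro mult_nonpos_nonneg mult_nonneg_nonpos) auto
        then show "\<exists>y. (g has_real_derivative y) (at v) \<and> y \<le> 0" using der by blast
      qed
      then show ?thesis by (simp add: g01)
    qed
  qed
  then have "exp (2 * u) * g u \<le> exp (2 * u) * 1" by (intro mult_left_mono) auto
  moreover have "exp (2 * u) * g u = (1 - u)\<^sup>2 + exp 2 * u\<^sup>2"
    by (simp add: g_def mult.assoc[symmetric] flip: exp_add)
  ultimately show ?thesis by simp
qed

text \<open>The difference of the two sides is concave in \<open>c\<close>; at \<open>c = 0\<close> it vanishes and at
  \<open>c = 2\<close> the claim is the preceding lemma.\<close>
lemma quadratic_le_exp_mult: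
  fixes b c :: real
  assumes "0 \<le> b" "b \<le> 1" "0 \<le> c" "c \<le> 2"
  shows "(1 - b)\<^sup>2 + exp c * b\<^sup>2 + (2 - c) * (b * (1 - b)) \<le> exp (c * b)"
proof -
  define f where "f x = (1 - b)\<^sup>2 + exp x * b\<^sup>2 + (2 - x) * (b * (1 - b)) - exp (x * b)" for x
  have "convex_on {0..2} f"
  proof (rule f''_ge0_imp_convex)
    show "convex {0..2::real}" by simp
    show "(f has_real_derivative exp x * b\<^sup>2 - b * (1 - b) - exp (x * b) * b) (at x)" for x
      unfolding f_def by (auto intro!: derivative_eq_intros)
    show "((\<lambda>x. exp x * b\<^sup>2 - b * (1 - b) - exp (x * b) * b) has_real_derivative
        exp x * b\<^sup>2 - exp (x * b) * b\<^sup>2) (at x)" for x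
      by (auto intro!: derivative_eq_intros simp: power2_eq_square)
    fix x :: real assume "x \<in> {0..2}"
    then have "x * b \<le> x * 1" using assms by (intro mult_left_mono) auto
    then have "exp (x * b) * b\<^sup>2 \<le> exp x * b\<^sup>2" by (intro mult_right_mono) auto
    then show "exp x * b\<^sup>2 - exp (x * b) * b\<^sup>2 \<ge> 0" by simp
  qed
  from convex_onD[OF this, of "c/2" 0 2] assms have "f c \<le> (1 - c/2) * f 0 + c/2 * f 2"
    by simp
  moreover have "f 0 = 0" by (simp add: f_def power2_eq_square algebra_simps)
  moreover have "f 2 \<le> 0" using quadratic_le_exp[OF assms(1)] by (simp add: f_def)
  ultimately have "f c \<le> 0" using assms(3) mult_nonneg_nonpos[of c "f 2"] by simp
  then show ?thesis by (simp add: f_def)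
qed

text \<open>The left side is the quartic of \<open>sensitivity_bound_scaled\<close> at
  \<open>b = a\<close>. For fixed \<open>a\<close> that quartic is quadratic in \<open>b\<close>
  with values \<open>q0\<close> at \<open>b = 0\<close> and \<open>q1\<close> at
  \<open>b = 1\<close>, and the exponent is \<open>t * a + c * b\<close>. Both values are bounded
  first, then \<open>quadratic_le_exp_mult\<close> is applied with \<open>b = a\<close>.\<close>

lemma diagonal_bound_le_1:
  fixes a t :: real
  assumes t: "0 \<le> t" "t \<le> 2" and a: "0 \<le> a" "a \<le> 1"
  shows "(1 - t * a + (t - 1) * a\<^sup>2)\<^sup>2 + exp 2 * t\<^sup>2 / 2 * (a * (1 - a))\<^sup>2 + exp (t + 2) * (a\<^sup>2)\<^sup>2
    \<le> exp (2 * t * a + (2 - t) * a\<^sup>2)"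
proof -
  define c where "c = t + (2 - t) * a"
  define q0 where "q0 = (1 - t * a / 2)\<^sup>2 + exp 2 * (t * a / 2)\<^sup>2"
  define q1 where "q1 = (1 - a)\<^sup>2 * ((1 - t / 2)\<^sup>2 + exp 2 * (t / 2)\<^sup>2) + exp (t + 2) * a\<^sup>2"
  have c2: "2 - c = (2 - t) * (1 - a)" by (simp add: c_def algebra_simps)
  have "0 \<le> 2 - c" unfolding c2 using t a by simp
  then have c: "0 \<le> c" "c \<le> 2" using t a by (simp_all add: c_def)
  have q0: "q0 \<le> exp (t * a)"
    using quadratic_le_exp[of "t * a / 2"] t a by (simp add: q0_def)
  \<comment> \<open>The axis bound is used twice, at \<open>t / 2\<close> and then at
    \<open>a\<close>; the exponents match because \<open>t + 2 * a = t * a + c\<close>.\<close>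
  have "q1 \<le> (1 - a)\<^sup>2 * exp t + exp (t + 2) * a\<^sup>2"
    using quadratic_le_exp[of "t / 2"] t by (auto simp: q1_def intro!: mult_left_mono)
  also have "\<dots> = exp t * ((1 - a)\<^sup>2 + exp 2 * a\<^sup>2)"
    by (simp add: exp_add algebra_simps)
  also have "\<dots> \<le> exp t * exp (2 * a)"
    using quadratic_le_exp[OF a(1)] by (intro mult_left_mono) auto
  also have "\<dots> = exp (t * a) * exp c"
    by (simp add: c_def algebra_simps flip: exp_add)
  finally have q1: "q1 \<le> exp (t * a) * exp c" .
  have "1 - t * a / 2 \<le> exp (t * a)" using t a by (simp add: order_trans[of _ 1])
  then have m: "(2 - c) * (1 - t * a / 2) \<le> (2 - c) * exp (t * a)"
    using c by (intro mult_left_mono) auto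
  have "(1 - t * a + (t - 1) * a\<^sup>2)\<^sup>2 + exp 2 * t\<^sup>2 / 2 * (a * (1 - a))\<^sup>2 + exp (t + 2) * (a\<^sup>2)\<^sup>2
    = q0 * (1 - a)\<^sup>2 + q1 * a\<^sup>2 + (2 - c) * (1 - t * a / 2) * (a * (1 - a))"
    unfolding q0_def q1_def c2 by (simp add: power2_eq_square field_simps)
  also have "\<dots> \<le> exp (t * a) * (1 - a)\<^sup>2 + exp (t * a) * exp c * a\<^sup>2
      + (2 - c) * exp (t * a) * (a * (1 - a))"
    using a by (intro add_mono mult_right_mono q0 q1 m) auto
  also have "\<dots> = exp (t * a) * ((1 - a)\<^sup>2 + exp c * a\<^sup>2 + (2 - c) * (a * (1 - a)))"
    by (simp add: algebra_simps)
  also have "\<dots> \<le> exp (t * a) * exp (c * a)"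
    using quadratic_le_exp_mult[OF a c] by (intro mult_left_mono) auto
  also have "\<dots> = exp (2 * t * a + (2 - t) * a\<^sup>2)"
    by (simp add: c_def power2_eq_square algebra_simps flip: exp_add)
  finally show ?thesis .
qed

text \<open>With \<open>a = 1 + d\<close> the factor \<open>exp (t + 2)\<close> splits off the right
  side. Each summand on the left is at most this factor times a polynomial in \<open>d\<close>, so
  the comparison reduces to a polynomial against \<open>exp (4 * d)\<close>.\<close>

lemma diagonal_bound_ge_1:
  fixes a t :: real
  assumes t: "0 \<le> t" "t \<le> 2" and a: "1 \<le> a"
  shows "(1 - t * a + (t - 1) * a\<^sup>2)\<^sup>2 + exp 2 * t\<^sup>2 / 2 * (a * (1 - a))\<^sup>2 + exp (t + 2) * (a\<^sup>2)\<^sup>2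
    \<le> exp (2 * t * a + (2 - t) * a\<^sup>2)"
proof -
  define d where "d = a - 1"
  have d: "0 \<le> d" and a_eq: "a = 1 + d" using a by (auto simp: d_def)
  have e1: "(2::real) \<le> exp 1" using exp_ge_add_one_self[of 1] by simp
  have "(2::real) * 2 \<le> exp 1 * exp 1" using e1 by (intro mult_mono) auto
  then have e2: "(4::real) \<le> exp 2" by (simp flip: exp_add)
  have "exp 2 \<le> exp (t + 2)" using t by simp
  with e2 have et: "4 \<le> exp (t + 2)" by (rule order_trans)
  have le1: "(1 - t * a + (t - 1) * a\<^sup>2)\<^sup>2 \<le> exp (t + 2) * (d\<^sup>2 * (2 + d)\<^sup>2 / 4)"
  proof -
    \<comment> \<open>The base of the first square is \<open>(1 - a) * (1 + (1 - t) * a)\<close>,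
      and \<open>1 - t\<close> lies between -1 and 1.\<close>
    have "\<bar>1 + (1 - t) * a\<bar> \<le> 1 + 1 * a"
      using t a mult_right_mono[of "1 - t" 1 a] mult_right_mono[of "-1" "1 - t" a]
      unfolding abs_le_iff by linarith
    then have "(1 + (1 - t) * a)\<^sup>2 \<le> (2 + d)\<^sup>2" by (simp add: a_eq power2_le_iff_abs_le d)
    then have "d\<^sup>2 * (1 + (1 - t) * a)\<^sup>2 \<le> d\<^sup>2 * (2 + d)\<^sup>2" by (intro mult_left_mono) auto
    moreover have "(1 - t * a + (t - 1) * a\<^sup>2)\<^sup>2 = d\<^sup>2 * (1 + (1 - t) * a)\<^sup>2"
      by (simp add: d_def power2_eq_square algebra_simps)
    moreover have "4 * (d\<^sup>2 * (2 + d)\<^sup>2 / 4) \<le> exp (t + 2) * (d\<^sup>2 * (2 + d)\<^sup>2 / 4)"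
      using et by (intro mult_right_mono) auto
    ultimately show ?thesis by simp
  qed
  have le2: "exp 2 * t\<^sup>2 / 2 * (a * (1 - a))\<^sup>2 \<le> exp (t + 2) * (d\<^sup>2 * (1 + d)\<^sup>2)"
  proof -
    have "t\<^sup>2 / 2 \<le> exp t" using exp_lower_Taylor_quadratic[OF t(1)] t by simp
    then have "exp 2 * (t\<^sup>2 / 2) * (a * (1 - a))\<^sup>2 \<le> exp 2 * exp t * (a * (1 - a))\<^sup>2"
      by (intro mult_right_mono mult_left_mono) auto
    moreover have "(a * (1 - a))\<^sup>2 = d\<^sup>2 * (1 + d)\<^sup>2" by (simp add: a_eq power2_eq_square)
    ultimately show ?thesis by (simp add: exp_add mult_ac)
  qed
  \<comment> \<open>The coefficients in \<open>d\<close> agree up to degree 2 and are larger on the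
    right in degrees 3 and 4.\<close>
  have "d\<^sup>2 * (2 + d)\<^sup>2 / 4 + d\<^sup>2 * (1 + d)\<^sup>2 + (a\<^sup>2)\<^sup>2 \<le> (1 + 2 * d + (2 * d)\<^sup>2 / 2)\<^sup>2"
    using d by (simp add: a_eq power2_eq_square algebra_simps)
  also have "\<dots> \<le> (exp (2 * d))\<^sup>2"
    using exp_lower_Taylor_quadratic[of "2 * d"] d by (intro power_mono) auto
  also have "\<dots> = exp (4 * d)" by (simp add: power2_eq_square flip: exp_add)
  also have "\<dots> \<le> exp (4 * d + (2 - t) * d\<^sup>2)" using t by simp
  finally have "exp (t + 2) * (d\<^sup>2 * (2 + d)\<^sup>2 / 4 + d\<^sup>2 * (1 + d)\<^sup>2 + (a\<^sup>2)\<^sup>2)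
    \<le> exp (t + 2) * exp (4 * d + (2 - t) * d\<^sup>2)" by (intro mult_left_mono) auto
  also have "\<dots> = exp (2 * t * a + (2 - t) * a\<^sup>2)"
    by (simp add: a_eq power2_eq_square algebra_simps flip: exp_add)
  finally show ?thesis using le1 le2 by (simp add: algebra_simps)
qed

text \<open>On a curve where the exponent is constant, the left-hand side is a convex quadratic
  function of \<open>a * b\<close>, so its maximum is attained on an axis or on the diagonal.\<close>
lemma sensitivity_bound_scaled:
  fixes a b t :: real
  assumes t: "0 < t" "t \<le> 2" and a: "0 \<le> a" and b: "0 \<le> b"
  shows "(1 - t * (a + b) / 2 + (t - 1) * (a * b))\<^sup>2
      + exp 2 * t\<^sup>2 / 4 * ((a * (1 - b))\<^sup>2 + (b * (1 - a))\<^sup>2) + exp (t + 2) * (a * b)\<^sup>2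
    \<le> exp (t * (a + b) + (2 - t) * (a * b))"
proof -
  define E where "E = t * (a + b) + (2 - t) * (a * b)"
  \<comment> \<open>In the variables \<open>G = a * b\<close> and \<open>z = t * (a + b)\<close> the
    left side is a positive combination of squares of affine functions plus a term linear in
    \<open>G\<close>, and the exponent is affine.\<close>
  define R where "R G z = (1 + (t - 1) * G - z / 2)\<^sup>2
    + exp 2 / 4 * ((z - t * G)\<^sup>2 + (t * G)\<^sup>2 - 2 * t\<^sup>2 * G) + exp (t + 2) * G\<^sup>2" for G z
  have E: "0 \<le> E" using t a b by (simp add: E_def)
  \<comment> \<open>\<open>(r, r)\<close> is the diagonal point on the level curve through
    \<open>(a, b)\<close>. At \<open>E / (2 * t)\<close> the linear term alone reaches
    \<open>E\<close>.\<close>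
  have "\<exists>r\<ge>0. r \<le> E / (2 * t) \<and> 2 * t * r + (2 - t) * r\<^sup>2 = E"
  proof (rule IVT)
    have "2 * t * (E / (2 * t)) = E" using t by simp
    then show "E \<le> 2 * t * (E / (2 * t)) + (2 - t) * (E / (2 * t))\<^sup>2" using t by simp
  qed (use E t in auto)
  then obtain r where r: "0 \<le> r" "2 * t * r + (2 - t) * r\<^sup>2 = E" by blast
  \<comment> \<open>The diagonal point has the largest product on the curve: a larger
    \<open>a * b\<close> forces \<open>a + b > 2 * r\<close> by AM-GM, and the exponent would exceed
    \<open>E\<close>.\<close>
  have ab: "a * b \<le> r\<^sup>2"
  proof (rule ccontr)
    assume "\<not> a * b \<le> r\<^sup>2"
    then have lt: "r\<^sup>2 < a * b" by simp
    have "4 * (a * b) \<le> (a + b)\<^sup>2" using sum_squares_bound[of a b] by (simp add: power2_sum)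
    with lt have "(2 * r)\<^sup>2 < (a + b)\<^sup>2" by (simp add: power_mult_distrib)
    then have "2 * r < a + b" using a b by (intro power2_less_imp_less[of "2 * r"]) auto
    then have "t * (2 * r) < t * (a + b)" using t by simp
    moreover have "(2 - t) * r\<^sup>2 \<le> (2 - t) * (a * b)" using lt t by (intro mult_left_mono) auto
    ultimately show False using r(2) unfolding E_def by simp
  qed
  have axis: "R 0 E \<le> exp E"
    using quadratic_le_exp[of "E / 2"] E by (simp add: R_def power2_eq_square)
  have "R (r\<^sup>2) (2 * t * r) = (1 - t * r + (t - 1) * r\<^sup>2)\<^sup>2 + exp 2 * t\<^sup>2 / 2 * (r * (1 - r))\<^sup>2 + exp (t + 2) * (r\<^sup>2)\<^sup>2"
    by (simp add: R_def power2_eq_square algebra_simps)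
  then have diagonal: "R (r\<^sup>2) (2 * t * r) \<le> exp E"
    using diagonal_bound_le_1[of t r] diagonal_bound_ge_1[of t r] r t by (cases "r \<le> 1") auto
  \<comment> \<open>In the \<open>(G, z)\<close> plane the level curve is a line, and
    \<open>\<theta>\<close> is the position of the given point between the axis point
    \<open>(0, E)\<close> and the diagonal point \<open>(r\<^sup>2, 2 * t * r)\<close>. If
    \<open>r = 0\<close> then \<open>a * b = 0\<close>, so the value 0 fits.\<close>
  define \<theta> where "\<theta> = (if r = 0 then 0 else a * b / r\<^sup>2)"
  have \<theta>: "0 \<le> \<theta>" "\<theta> \<le> 1" using ab a b r by (auto simp: \<theta>_def)
  have ab_eq: "a * b = \<theta> * r\<^sup>2" using ab mult_nonneg_nonneg[OF a b] by (auto simp: \<theta>_def simp del: mult_eq_0_iff)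
  have z_eq: "t * (a + b) = (1 - \<theta>) * E + \<theta> * (2 * t * r)"
  proof -
    have "t * (a + b) = E - (2 - t) * (\<theta> * r\<^sup>2)" unfolding ab_eq[symmetric] by (simp add: E_def)
    also have "\<dots> = E - \<theta> * (E - 2 * t * r)" by (simp add: r(2)[symmetric] algebra_simps)
    finally show ?thesis by (simp add: algebra_simps)
  qed
  have sq: "((1 - \<theta>) * p + \<theta> * q)\<^sup>2 \<le> (1 - \<theta>) * p\<^sup>2 + \<theta> * q\<^sup>2" for p q :: real
  proof -
    have "(1 - \<theta>) * p\<^sup>2 + \<theta> * q\<^sup>2 - ((1 - \<theta>) * p + \<theta> * q)\<^sup>2 = \<theta> * (1 - \<theta>) * (p - q)\<^sup>2"
      by (simp add: power2_eq_square algebra_simps)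
    also have "\<dots> \<ge> 0" using \<theta> by simp
    finally show ?thesis by simp
  qed
  define G z where "G = \<theta> * r\<^sup>2" and "z = (1 - \<theta>) * E + \<theta> * (2 * t * r)"
  have l1: "1 + (t - 1) * G - z / 2 = (1 - \<theta>) * (1 - E / 2) + \<theta> * (1 + (t - 1) * r\<^sup>2 - (2 * t * r) / 2)"
    and l2: "z - t * G = (1 - \<theta>) * E + \<theta> * (2 * t * r - t * r\<^sup>2)"
    and l3: "t * G = (1 - \<theta>) * 0 + \<theta> * (t * r\<^sup>2)"
    and l4: "G = (1 - \<theta>) * 0 + \<theta> * r\<^sup>2"
    unfolding G_def z_def by (simp_all add: field_simps)
  \<comment> \<open>The convexity bound \<open>sq\<close> is applied to each square; the linear term
    \<open>2 * t\<^sup>2 * G\<close> is carried along unchanged.\<close>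
  have "R G z \<le> ((1 - \<theta>) * (1 - E / 2)\<^sup>2 + \<theta> * (1 + (t - 1) * r\<^sup>2 - (2 * t * r) / 2)\<^sup>2)
      + exp 2 / 4 * (((1 - \<theta>) * E\<^sup>2 + \<theta> * (2 * t * r - t * r\<^sup>2)\<^sup>2)
        + ((1 - \<theta>) * 0\<^sup>2 + \<theta> * (t * r\<^sup>2)\<^sup>2) - 2 * t\<^sup>2 * G)
      + exp (t + 2) * ((1 - \<theta>) * 0\<^sup>2 + \<theta> * (r\<^sup>2)\<^sup>2)"
    unfolding R_def
  proof (intro add_mono mult_left_mono diff_mono order_refl)
    show "(1 + (t - 1) * G - z / 2)\<^sup>2 \<le> (1 - \<theta>) * (1 - E / 2)\<^sup>2 + \<theta> * (1 + (t - 1) * r\<^sup>2 - (2 * t * r) / 2)\<^sup>2"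
      unfolding l1 by (rule sq)
    show "(z - t * G)\<^sup>2 \<le> (1 - \<theta>) * E\<^sup>2 + \<theta> * (2 * t * r - t * r\<^sup>2)\<^sup>2" unfolding l2 by (rule sq)
    show "(t * G)\<^sup>2 \<le> (1 - \<theta>) * 0\<^sup>2 + \<theta> * (t * r\<^sup>2)\<^sup>2" unfolding l3 by (rule sq)
    show "G\<^sup>2 \<le> (1 - \<theta>) * 0\<^sup>2 + \<theta> * (r\<^sup>2)\<^sup>2" by (subst l4) (rule sq)
  qed auto
  also have "\<dots> = (1 - \<theta>) * R 0 E + \<theta> * R (r\<^sup>2) (2 * t * r)"
    by (simp add: R_def G_def field_simps)
  also have "\<dots> \<le> (1 - \<theta>) * exp E + \<theta> * exp E"
    using \<theta> by (intro add_mono mult_left_mono axis diagonal) auto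
  finally have "R (a * b) (t * (a + b)) \<le> exp E"
    unfolding G_def z_def ab_eq[symmetric] z_eq[symmetric] by (simp add: algebra_simps)
  moreover have "R (a * b) (t * (a + b)) = (1 - t * (a + b) / 2 + (t - 1) * (a * b))\<^sup>2
      + exp 2 * t\<^sup>2 / 4 * ((a * (1 - b))\<^sup>2 + (b * (1 - a))\<^sup>2) + exp (t + 2) * (a * b)\<^sup>2"
    by (simp add: R_def power2_eq_square field_simps)
  ultimately show ?thesis by (simp add: E_def)
qed

text \<open>The squares are those of the interpolation coefficients in
  \<open>regf_interpolation\<close>; \<open>exp 2\<close> and \<open>exp (t + 2)\<close> are the
  reciprocal intensities at the axis points and at the pair point, and
  \<open>(2 - t) / t\<^sup>2\<close> is the value of \<open>rho\<close>. The proof rescales to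
  \<open>x = t * a\<close>, \<open>y = t * b\<close>.\<close>

lemma sensitivity_bound:
  fixes x y t :: real
  assumes t: "0 < t" "t \<le> 2" and x: "0 \<le> x" and y: "0 \<le> y"
  shows "(1 - x / 2 - y / 2 + (t - 1) * (x * y / t\<^sup>2))\<^sup>2
      + exp 2 * ((x / 2 * (1 - y / t))\<^sup>2 + (y / 2 * (1 - x / t))\<^sup>2) + exp (t + 2) * (x * y / t\<^sup>2)\<^sup>2
    \<le> exp (x + y + (2 - t) / t\<^sup>2 * (x * y))"
proof -
  define a b where "a = x / t" and "b = y / t"
  have xy: "x = t * a" "y = t * b" using t by (auto simp: a_def b_def)
  have quot: "x * y / t\<^sup>2 = a * b" "y / t = b" "x / t = a"
    using t by (auto simp: xy power2_eq_square)
  have "1 - x / 2 - y / 2 + (t - 1) * (x * y / t\<^sup>2) = 1 - t * (a + b) / 2 + (t - 1) * (a * b)"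
    unfolding quot by (simp add: xy field_simps)
  moreover have "exp 2 * ((x / 2 * (1 - y / t))\<^sup>2 + (y / 2 * (1 - x / t))\<^sup>2)
    = exp 2 * t\<^sup>2 / 4 * ((a * (1 - b))\<^sup>2 + (b * (1 - a))\<^sup>2)"
    unfolding quot by (simp add: xy power2_eq_square field_simps)
  moreover have "x + y + (2 - t) / t\<^sup>2 * (x * y) = t * (a + b) + (2 - t) * (a * b)"
    using quot(1) by (simp add: xy(1,2) distrib_left flip: times_divide_eq_right)
  moreover have "0 \<le> a" "0 \<le> b" using t x y by (auto simp: a_def b_def)
  ultimately show ?thesis
    using sensitivity_bound_scaled[OF t, of a b] by (simp only: quot(1))
qed

section \<open>Determinants of positive semidefinite matrices\<close>

text \<open>Left multiplication by the unitriangular \<open>U\<close> subtracts multiples of the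
  last row and clears the last column above the corner; expansion along that column leaves the Schur
  complement.\<close>

lemma det_Schur_complement:
  fixes a :: "nat \<Rightarrow> nat \<Rightarrow> real"
  assumes "a n n \<noteq> 0"
  shows "det (mat (Suc n) (Suc n) (\<lambda>(i,j). a i j)) =
    a n n * det (mat n n (\<lambda>(i,j). a i j - a i n * a n j / a n n))"
proof -
  let ?A = "mat (Suc n) (Suc n) (\<lambda>(i,j). a i j)"
  define U where "U = mat (Suc n) (Suc n)
    (\<lambda>(i,j). if i = j then 1 else if j = n then - a i n / a n n else 0)"
  let ?B = "mat (Suc n) (Suc n) (\<lambda>(i,j). if i = n then a n j else a i j - a i n * a n j / a n n)"
  have U: "U \<in> carrier_mat (Suc n) (Suc n)" by (simp add: U_def)
  have "det U = prod_list (diag_mat U)"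
    by (rule det_upper_triangular[OF _ U]) (auto simp: U_def)
  also have "diag_mat U = replicate (Suc n) 1"
    by (rule nth_equalityI) (auto simp: diag_mat_def U_def simp del: replicate_Suc upt_Suc)
  finally have detU: "det U = 1" by simp
  have "U * ?A = ?B"
  proof (rule eq_matI)
    fix i j assume ij: "i < dim_row ?B" "j < dim_col ?B"
    then have "(U * ?A) $$ (i,j) = (\<Sum>l<Suc n. U $$ (i,l) * a l j)"
      by (auto simp: U_def scalar_prod_def lessThan_atLeast0 intro!: sum.cong)
    also have "\<dots> = ?B $$ (i,j)"
    proof (cases "i = n")
      case True
      then have "(\<Sum>l<Suc n. U $$ (i,l) * a l j) = (\<Sum>l<Suc n. if l = n then a n j else 0)"
        by (intro sum.cong) (auto simp: U_def)
      then show ?thesis using ij True by simp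
    next
      case False
      then have "(\<Sum>l<n. U $$ (i,l) * a l j) = (\<Sum>l<n. if l = i then a i j else 0)"
        using ij by (intro sum.cong) (auto simp: U_def)
      moreover have "U $$ (i,n) * a n j = - (a i n * a n j / a n n)" 
        using ij False by (auto simp: U_def)
      ultimately show ?thesis using ij False by simp
    qed
    finally show "(U * ?A) $$ (i,j) = ?B $$ (i,j)" .
  qed (auto simp: U_def)
  moreover have "det (U * ?A) = det ?A"
    using det_mult[OF U, of ?A] detU by simp
  moreover have "det ?B = (\<Sum>i<Suc n. ?B $$ (i,n) * cofactor ?B i n)"
    by (rule laplace_expansion_column) auto
  moreover have "\<dots> = ?B $$ (n,n) * cofactor ?B n n"
    using assms by (subst sum.lessThan_Suc) simp
  moreover have "mat_delete ?B n n = mat n n (\<lambda>(i,j). a i j - a i n * a n j / a n n)"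
    by (rule eq_matI) (auto simp: mat_delete_def)
  ultimately show ?thesis by (simp add: cofactor_def)
qed

lemma quadratic_form_unit_vector:
  fixes a :: "nat \<Rightarrow> nat \<Rightarrow> real"
  assumes "l < n"
  shows "(\<Sum>i<n. \<Sum>j<n. of_bool (i = l) * of_bool (j = l) * a i j) = a l l"
proof -
  have "(\<Sum>i<n. \<Sum>j<n. of_bool (i = l) * of_bool (j = l) * a i j)
    = (\<Sum>i<n. of_bool (i = l) * (\<Sum>j<n. if j = l then a i j else 0))"
    unfolding sum_distrib_left by (intro sum.cong) auto
  also have "\<dots> = (\<Sum>i<n. if i = l then a i l else 0)"
    using assms by (intro sum.cong) auto
  finally show ?thesis using assms by simp
qed

text \<open>Induction on the size. A positive corner entry splits off, and the Schur complement is
  again positive semidefinite with no larger diagonal entries. A zero corner forces its whole column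
  to vanish, so determinant and product are both 0.\<close>

lemma hadamard_psd:
  fixes a :: "nat \<Rightarrow> nat \<Rightarrow> real"
  assumes sym: "\<And>i j. i < n \<Longrightarrow> j < n \<Longrightarrow> a i j = a j i"
    and psd: "\<And>v. 0 \<le> (\<Sum>i<n. \<Sum>j<n. v i * v j * a i j)"
  shows "0 \<le> det (mat n n (\<lambda>(i,j). a i j))"
    and "det (mat n n (\<lambda>(i,j). a i j)) \<le> (\<Prod>i<n. a i i)"
proof -
  have "0 \<le> det (mat n n (\<lambda>(i,j). a i j)) \<and> det (mat n n (\<lambda>(i,j). a i j)) \<le> (\<Prod>i<n. a i i)"
    using assms
  proof (induction n arbitrary: a)
    case 0
    then show ?case by simp
  next
    case (Suc n)
    note sym = Suc.prems(1) and psd = Suc.prems(2)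
    have diag: "0 \<le> a l l" if "l < Suc n" for l
      using psd[of "\<lambda>i. of_bool (i = l)"] quadratic_form_unit_vector[OF that, of a] by simp
    have split: "(\<Sum>i<Suc n. \<Sum>j<Suc n. v i * v j * a i j) =
      (\<Sum>i<n. \<Sum>j<n. v i * v j * a i j) + 2 * v n * (\<Sum>i<n. v i * a i n) + (v n)\<^sup>2 * a n n" for v
    proof -
      have "(\<Sum>i<n. v n * v i * a n i) = v n * (\<Sum>i<n. v i * a i n)"
        unfolding sum_distrib_left by (intro sum.cong) (auto simp: sym)
      moreover have "(\<Sum>i<n. v i * v n * a i n) = v n * (\<Sum>i<n. v i * a i n)"
        unfolding sum_distrib_left by (intro sum.cong) auto
      ultimately show ?thesis by (simp add: sum.distrib power2_eq_square)
    qed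
    show ?case
    proof (cases "a n n = 0")
      case True
      have col: "a i n = 0" if "i < n" for i
      proof (rule ccontr)
        assume ne: "a i n \<noteq> 0"
        \<comment> \<open>The form at \<open>v\<close> is \<open>a i i + 2 * v n * a i n\<close>,
          and \<open>v n\<close> is chosen to make this -1.\<close>
        define v where "v l = (if l = n then - (a i i + 1) / (2 * a i n) else of_bool (l = i))" for l
        have "(\<Sum>l<n. \<Sum>j<n. v l * v j * a l j) = (\<Sum>l<n. \<Sum>j<n. of_bool (l = i) * of_bool (j = i) * a l j)"
          by (intro sum.cong) (auto simp: v_def)
        then have "(\<Sum>l<n. \<Sum>j<n. v l * v j * a l j) = a i i"
          using quadratic_form_unit_vector[OF that, of a] by simp
        moreover have "(\<Sum>l<n. v l * a l n) = (\<Sum>l<n. if l = i then a l n else 0)"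
          using that by (intro sum.cong) (auto simp: v_def)
        ultimately have "(\<Sum>i<Suc n. \<Sum>j<Suc n. v i * v j * a i j) = -1"
          using that ne by (simp only: split True) (simp add: v_def field_simps)
        with psd[of v] show False by linarith
      qed
      let ?A = "mat (Suc n) (Suc n) (\<lambda>(i,j). a i j)"
      have "det ?A = (\<Sum>i<Suc n. ?A $$ (i,n) * cofactor ?A i n)"
        by (rule laplace_expansion_column) auto
      also have "\<dots> = 0" using True col by (intro sum.neutral) (auto simp: less_Suc_eq)
      finally show ?thesis using True by simp
    next
      case False
      then have pos: "0 < a n n" using diag[of n] by simp
      define b where "b i j = a i j - a i n * a n j / a n n" for i j
      have psdb: "0 \<le> (\<Sum>i<n. \<Sum>j<n. v i * v j * b i j)" for v
      proof -
        define S where "S = (\<Sum>i<n. v i * a i n)"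
        have "(\<Sum>i<n. \<Sum>j<n. v i * v j * b i j) =
          (\<Sum>i<n. \<Sum>j<n. v i * v j * a i j) - (\<Sum>i<n. \<Sum>j<n. (v i * a i n) * (v j * a j n)) / a n n"
          unfolding sum_divide_distrib sum_subtractf[symmetric]
          by (intro sum.cong) (auto simp: b_def sym algebra_simps)
        also have "(\<Sum>i<n. \<Sum>j<n. (v i * a i n) * (v j * a j n)) = S * S"
          by (simp add: S_def sum_product)
        finally have *: "(\<Sum>i<n. \<Sum>j<n. v i * v j * b i j) = (\<Sum>i<n. \<Sum>j<n. v i * v j * a i j) - S * S / a n n" .
        \<comment> \<open>This last coordinate minimises the form of \<open>a\<close>; the minimum
          is the form of \<open>b\<close> at \<open>v\<close>.\<close>
        let ?v = "v(n := - S / a n n)"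
        have "(\<Sum>i<n. ?v i * a i n) = S" unfolding S_def by (intro sum.cong) auto
        moreover have "(\<Sum>i<n. \<Sum>j<n. ?v i * ?v j * a i j) = (\<Sum>i<n. \<Sum>j<n. v i * v j * a i j)"
          by (intro sum.cong) auto
        ultimately have "0 \<le> (\<Sum>i<n. \<Sum>j<n. v i * v j * a i j) + 2 * (- S / a n n) * S + (- S / a n n)\<^sup>2 * a n n"
          using psd[of ?v] unfolding split by simp
        then show ?thesis unfolding * using pos by (simp add: power2_eq_square field_simps)
      qed
      have symb: "b i j = b j i" if "i < n" "j < n" for i j
        using that sym[of i j] sym[of i n] sym[of j n] by (simp add: b_def)
      have IH: "0 \<le> det (mat n n (\<lambda>(i,j). b i j))" "det (mat n n (\<lambda>(i,j). b i j)) \<le> (\<Prod>i<n. b i i)"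
        using Suc.IH[of b] symb psdb by auto
      have det: "det (mat (Suc n) (Suc n) (\<lambda>(i,j). a i j)) = a n n * det (mat n n (\<lambda>(i,j). b i j))"
        unfolding b_def using False by (rule det_Schur_complement)
      have "(\<Prod>i<n. b i i) \<le> (\<Prod>i<n. a i i)"
      proof (rule prod_mono)
        fix i assume i: "i \<in> {..<n}"
        have "b i i = a i i - (a i n)\<^sup>2 / a n n" using i sym[of n i] by (simp add: b_def power2_eq_square)
        then show "0 \<le> b i i \<and> b i i \<le> a i i"
          using psdb[of "\<lambda>l. of_bool (l = i)"] quadratic_form_unit_vector[of i n b] i pos by simp
      qed
      with IH pos show ?thesis unfolding det by (simp add: mult.commute)
    qed
  qed
  then show "0 \<le> det (mat n n (\<lambda>(i,j). a i j))"
    and "det (mat n n (\<lambda>(i,j). a i j)) \<le> (\<Prod>i<n. a i i)" by auto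
qed

text \<open>AM-GM by way of \<open>y \<le> exp (y - 1)\<close> at \<open>y = real n * d i\<close>:
  the exponents add up to at most 0.\<close>

lemma prod_le_of_sum_le_1:
  fixes d :: "nat \<Rightarrow> real"
  assumes "\<And>i. i < n \<Longrightarrow> 0 \<le> d i" "(\<Sum>i<n. d i) \<le> 1"
  shows "(\<Prod>i<n. d i) \<le> (1 / real n) ^ n"
proof (cases "n = 0")
  case False
  have "(\<Prod>i<n. real n * d i) \<le> (\<Prod>i<n. exp (real n * d i - 1))"
  proof (rule prod_mono)
    fix i assume "i \<in> {..<n}"
    then show "0 \<le> real n * d i \<and> real n * d i \<le> exp (real n * d i - 1)"
      using assms(1)[of i] exp_ge_add_one_self[of "real n * d i - 1"] by simp
  qed
  also have "\<dots> = exp (real n * (\<Sum>i<n. d i) - real n)"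
    by (simp add: exp_sum[symmetric] sum_subtractf sum_distrib_left)
  also have "\<dots> \<le> 1" using assms(2) mult_left_mono[OF assms(2), of "real n"] by simp
  finally show ?thesis using False by (simp add: prod.distrib field_simps)
qed simp

text \<open>Both determinants contain the factor \<open>det G * det G\<close>. What remains is to
  compare \<open>det N\<close>, for the weighted second moments \<open>N\<close> of the coefficient
  vectors, with the determinant of \<open>1 / n\<close> times the identity.\<close>

lemma det_gram_le:
  fixes f h :: "'a \<Rightarrow> nat \<Rightarrow> real" and g :: "nat \<Rightarrow> nat \<Rightarrow> real"
  assumes w: "\<And>x. x \<in> S \<Longrightarrow> 0 \<le> w x" "(\<Sum>x\<in>S. w x) = 1"
    and f: "\<And>x a. x \<in> S \<Longrightarrow> a < n \<Longrightarrow> f x a = (\<Sum>s<n. h x s * g s a)"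
    and h: "\<And>x. x \<in> S \<Longrightarrow> (\<Sum>s<n. (h x s)\<^sup>2) \<le> 1"
  shows "det (mat n n (\<lambda>(a,b). \<Sum>x\<in>S. w x * f x a * f x b))
    \<le> det (mat n n (\<lambda>(a,b). \<Sum>s<n. 1 / real n * g s a * g s b))"
proof -
  define N where "N s r = (\<Sum>x\<in>S. w x * h x s * h x r)" for s r
  let ?N = "mat n n (\<lambda>(s,r). N s r)"
  define G where "G = mat n n (\<lambda>(s,a). g s a)"
  have G: "G \<in> carrier_mat n n" "transpose_mat G \<in> carrier_mat n n" by (auto simp: G_def)
  \<comment> \<open>\<open>K\<close> is kept general so that the factorisation serves both
    \<open>N\<close> and the scaled identity.\<close>
  have prod: "det (mat n n (\<lambda>(a,b). \<Sum>s<n. \<Sum>r<n. g s a * K s r * g r b))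
    = det G * det G * det (mat n n (\<lambda>(s,r). K s r))" for K
  proof -
    let ?K = "mat n n (\<lambda>(s,r). K s r)"
    have "mat n n (\<lambda>(a,b). \<Sum>s<n. \<Sum>r<n. g s a * K s r * g r b) = transpose_mat G * (?K * G)"
      by (rule eq_matI)
        (auto simp: G_def scalar_prod_def lessThan_atLeast0 sum_distrib_left mult.assoc intro!: sum.cong)
    also have "det \<dots> = det G * (det ?K * det G)"
      using G det_mult[OF G(2), of "?K * G"] det_mult[of ?K n G] det_transpose[OF G(1)]
        mult_carrier_mat[of ?K n n G n] by simp
    finally show ?thesis by simp
  qed
  have L: "(\<Sum>x\<in>S. w x * f x a * f x b) = (\<Sum>s<n. \<Sum>r<n. g s a * N s r * g r b)" if "a < n" "b < n" for a b
  proof -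
    have "(\<Sum>x\<in>S. w x * f x a * f x b) = (\<Sum>x\<in>S. \<Sum>s<n. \<Sum>r<n. g s a * (w x * h x s * h x r) * g r b)"
      by (intro sum.cong) (auto simp: f that sum_distrib_left sum_distrib_right mult_ac intro!: sum.cong)
    also have "\<dots> = (\<Sum>s<n. \<Sum>x\<in>S. \<Sum>r<n. g s a * (w x * h x s * h x r) * g r b)"
      by (rule sum.swap)
    also have "\<dots> = (\<Sum>s<n. \<Sum>r<n. \<Sum>x\<in>S. g s a * (w x * h x s * h x r) * g r b)"
      by (intro sum.cong refl sum.swap)
    finally show ?thesis by (simp add: N_def sum_distrib_left sum_distrib_right)
  qed
  have R: "(\<Sum>s<n. 1 / real n * g s a * g s b)
    = (\<Sum>s<n. \<Sum>r<n. g s a * (if s = r then 1 / real n else 0) * g r b)" for a b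
    by (intro sum.cong refl) (simp add: if_distrib if_distribR cong: if_cong)
  have "det (mat n n (\<lambda>(s,r). if s = r then 1 / real n else 0)) = det ((1 / real n) \<cdot>\<^sub>m 1\<^sub>m n)"
    by (intro arg_cong[of _ _ det] eq_matI) auto
  then have D: "det (mat n n (\<lambda>(s,r). if s = r then 1 / real n else 0)) = (1 / real n) ^ n"
    by simp
  have Nss: "N s s = (\<Sum>x\<in>S. w x * (h x s)\<^sup>2)" for s by (simp add: N_def power2_eq_square mult.assoc)
  have "det ?N \<le> (\<Prod>s<n. N s s)"
  proof (rule hadamard_psd(2))
    show "N i j = N j i" for i j by (simp add: N_def mult_ac)
    fix v
    \<comment> \<open>The form of \<open>N\<close> at \<open>v\<close> is the weighted sum of the
      squared scalar products of \<open>v\<close> with \<open>h x\<close>.\<close>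
    have "(\<Sum>i<n. \<Sum>j<n. v i * v j * N i j) = (\<Sum>i<n. \<Sum>j<n. \<Sum>x\<in>S. w x * ((v i * h x i) * (v j * h x j)))"
      by (simp add: N_def sum_distrib_left mult_ac)
    also have "\<dots> = (\<Sum>i<n. \<Sum>x\<in>S. \<Sum>j<n. w x * ((v i * h x i) * (v j * h x j)))"
      by (intro sum.cong refl sum.swap)
    also have "\<dots> = (\<Sum>x\<in>S. \<Sum>i<n. \<Sum>j<n. w x * ((v i * h x i) * (v j * h x j)))"
      by (rule sum.swap)
    also have "\<dots> = (\<Sum>x\<in>S. w x * ((\<Sum>i<n. v i * h x i) * (\<Sum>i<n. v i * h x i)))"
      unfolding sum_product by (simp add: sum_distrib_left)
    also have "\<dots> \<ge> 0" by (intro sum_nonneg mult_nonneg_nonneg[OF w(1)] zero_le_square)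
    finally show "0 \<le> (\<Sum>i<n. \<Sum>j<n. v i * v j * N i j)" .
  qed
  also have "\<dots> \<le> (1 / real n) ^ n"
  proof (rule prod_le_of_sum_le_1)
    show "0 \<le> N s s" for s unfolding Nss by (intro sum_nonneg mult_nonneg_nonneg w) auto
    \<comment> \<open>The trace of \<open>N\<close> is the weighted mean of the squared norms of the
      \<open>h x\<close>.\<close>
    have "(\<Sum>s<n. N s s) = (\<Sum>x\<in>S. w x * (\<Sum>s<n. (h x s)\<^sup>2))"
      unfolding Nss sum_distrib_left by (rule sum.swap)
    also have "\<dots> \<le> (\<Sum>x\<in>S. w x * 1)" by (intro sum_mono mult_left_mono h w)
    finally show "(\<Sum>s<n. N s s) \<le> 1" using w(2) by simp
  qed
  finally have "det G * det G * det ?N \<le> det G * det G * (1 / real n) ^ n"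
    by (intro mult_left_mono) auto
  moreover have "mat n n (\<lambda>(a,b). \<Sum>x\<in>S. w x * f x a * f x b)
    = mat n n (\<lambda>(a,b). \<Sum>s<n. \<Sum>r<n. g s a * N s r * g r b)"
    by (rule eq_matI) (auto simp: L)
  ultimately show ?thesis unfolding R by (simp only: prod D)
qed

section \<open>The Poisson model with interactions\<close>

lemma set_pairs: "set (pairs k) = {(i, j). i < j \<and> j < k}"
  by (force simp: pairs_def)

lemma set_pairs_Sigma: "set (pairs k) = (SIGMA i:{..<k}. {Suc i..<k})"
  by (auto simp: set_pairs)

lemma card_pairs: "card (set (pairs k)) = length (pairs k)"
  unfolding set_pairs_Sigma
  by (simp add: pairs_def length_concat sum_list_distinct_conv_sum_set comp_def lessThan_atLeast0)

lemma distinct_pairs: "distinct (pairs k)"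
  by (rule card_distinct) (rule card_pairs)

lemma length_pairs: "length (pairs k) = k * (k - 1) div 2"
proof -
  have "length (pairs k) = (\<Sum>i<k. k - Suc i)"
    by (simp add: set_pairs_Sigma flip: card_pairs)
  also have "\<dots> = \<Sum>{0..<k}"
    using sum.nat_diff_reindex[of id k] by (simp add: lessThan_atLeast0)
  finally show ?thesis by (simp add: Sum_Ico_nat)
qed

lemma sum_nth_pairs: "(\<Sum>q<length (pairs k). \<phi> (pairs k ! q)) = (\<Sum>p\<in>set (pairs k). \<phi> p)"
  by (rule sum.reindex_bij_betw) (rule bij_betw_nth[OF distinct_pairs], auto)

text \<open>Linear identities between regression vectors can thus be checked on three kinds of
  monomials. Index 0 holds the constant, indices 1 to \<open>k\<close> the coordinates, and later
  ones the products.\<close>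

lemma regf_nth_cases:
  assumes "a < npar k"
  obtains (const) "\<And>x. regf k x ! a = 1"
  | (linear) l where "l < k" "\<And>x. regf k x ! a = x l"
  | (interaction) l m where "l < m" "m < k" "\<And>x. regf k x ! a = x l * x m"
proof (cases a)
  case 0
  then show ?thesis using const by (simp add: regf_def)
next
  case (Suc b)
  show ?thesis
  proof (cases "b < k")
    case True
    then show ?thesis using linear[of b] Suc by (simp add: regf_def nth_append)
  next
    case False
    then have q: "b - k < length (pairs k)" using assms Suc by (simp add: npar_def)
    then have "pairs k ! (b - k) \<in> set (pairs k)" by (rule nth_mem)
    then obtain l m where "pairs k ! (b - k) = (l, m)" "l < m" "m < k" by (auto simp: set_pairs)
    then show ?thesis using interaction[of l m] Suc False q by (simp add: regf_def nth_append)
  qed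
qed

lemma sum_lessThan_add: "(\<Sum>a<k + m. \<phi> a) = (\<Sum>a<k. \<phi> a) + (\<Sum>q<m. \<phi> (k + q))"
  for \<phi> :: "nat \<Rightarrow> real"
  by (induction m) auto

lemma Xreg_iff: "x \<in> Xreg k \<longleftrightarrow> (\<exists>i j. i < j \<and> j < k \<and> x \<in> Xij i j)"
  unfolding Xreg_def UN_iff atLeastLessThan_iff lessThan_iff Suc_le_eq Bex_def
  by (meson less_trans)

lemma intensity_Xij:
  assumes ij: "i < j" "j < k" and x: "x \<in> Xij i j"
  shows "intensity k (beta_of k rho) x = exp (- (x i + x j + rho i j * (x i * x j)))"
proof -
  have x0: "x l = 0" if "l \<noteq> i" "l \<noteq> j" for l using x that by (auto simp: Xij_def)
  have "(\<Sum>a<npar k. regf k x ! a * beta_of k rho ! a)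
    = (\<Sum>l<k. - x l) + (\<Sum>q<length (pairs k). (\<lambda>(l, m). x l * x m * - rho l m) (pairs k ! q))"
    \<comment> \<open>The index range splits into 0, where the parameter is 0, the \<open>k\<close>
      linear positions and the pair positions.\<close>
    unfolding npar_def plus_1_eq_Suc add_Suc sum.lessThan_Suc_shift sum_lessThan_add
    by (simp add: regf_def beta_of_def nth_append case_prod_beta)
  also have "(\<Sum>l<k. - x l) = (\<Sum>l\<in>{i, j}. - x l)"
    using ij by (intro sum.mono_neutral_right) (auto simp: x0)
  also have "(\<Sum>q<length (pairs k). (\<lambda>(l, m). x l * x m * - rho l m) (pairs k ! q))
    = (\<Sum>(l, m)\<in>{(i, j)}. x l * x m * - rho l m)"
    unfolding sum_nth_pairs
  proof (rule sum.mono_neutral_right)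
    show "\<forall>p\<in>set (pairs k) - {(i, j)}. (case p of (l, m) \<Rightarrow> x l * x m * - rho l m) = 0"
    proof
      fix p assume p: "p \<in> set (pairs k) - {(i, j)}"
      obtain l m where lm: "p = (l, m)" by (cases p)
      then have "l \<notin> {i, j} \<or> m \<notin> {i, j}" using p ij by (auto simp: set_pairs)
      then show "(case p of (l, m) \<Rightarrow> x l * x m * - rho l m) = 0" using x0 by (auto simp: lm)
    qed
    have "(i, j) \<in> set (pairs k)" using ij by (simp add: set_pairs)
    then show "{(i, j)} \<subseteq> set (pairs k)" by simp
  qed simp
  finally show ?thesis using ij by (simp add: intensity_def mult_ac)
qed

text \<open>\<open>tval r\<close> is the positive root of \<open>r * t\<^sup>2 + t = 2\<close>.
  Rationalising turns it into \<open>4 / u\<close> with \<open>u > 2\<close>, from which the bounds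
  are visible.\<close>

lemma tval:
  assumes "0 \<le> r"
  shows "0 < tval r" "tval r \<le> 2" "r * (tval r)\<^sup>2 = 2 - tval r"
proof -
  have "0 < tval r \<and> tval r \<le> 2 \<and> r * (tval r)\<^sup>2 = 2 - tval r"
  proof (cases "r = 0")
    case False
    define u where "u = sqrt (1 + 8 * r) + 1"
    have "(u - 1)\<^sup>2 = 1 + 8 * r" using assms by (simp add: u_def)
    then have r: "r = u * (u - 2) / 8" by (simp add: power2_eq_square algebra_simps)
    have u: "2 < u" using assms False by (simp add: u_def)
    have "(u - 2) / (2 * r) = 4 / u"
      using u False by (subst frac_eq_eq) (auto simp: r)
    then have t: "tval r = 4 / u" using assms False by (simp add: tval_def u_def)
    show ?thesis unfolding t using u by (simp add: r field_simps power2_eq_square)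
  qed (simp add: tval_def)
  then show "0 < tval r" "tval r \<le> 2" "r * (tval r)\<^sup>2 = 2 - tval r" by auto
qed

section \<open>The support points and interpolation at them\<close>

definition axis_pt :: "nat \<Rightarrow> nat \<Rightarrow> real" where
  "axis_pt i = (\<lambda>l. if l = i then 2 else 0)"

definition pair_pt :: "(nat \<Rightarrow> nat \<Rightarrow> real) \<Rightarrow> nat \<times> nat \<Rightarrow> nat \<Rightarrow> real" where
  "pair_pt rho = (\<lambda>(i, j) l. if l = i \<or> l = j then tval (rho i j) else 0)"

lemma opt_support_eq:
  "opt_support k rho = insert (\<lambda>_. 0) (axis_pt ` {..<k} \<union> pair_pt rho ` set (pairs k))"
  by (auto simp: opt_support_def axis_pt_def pair_pt_def set_pairs image_iff) 

lemma finite_opt_support: "finite (opt_support k rho)"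
  by (simp add: opt_support_eq)

text \<open>The points are told apart by their sets of nonzero coordinates: empty, a singleton or a
  doubleton, the last because \<open>tval\<close> is positive. There are thus as many support points
  as parameters.\<close>

lemma card_opt_support:
  assumes rho: "\<And>i j. i < j \<Longrightarrow> j < k \<Longrightarrow> rho i j \<ge> 0"
  shows "card (opt_support k rho) = npar k"
proof -
  have t: "0 < tval (rho i j)" if "(i, j) \<in> set (pairs k)" for i j
    using that tval(1)[OF rho] by (simp add: set_pairs)
  have supp: "{l. axis_pt i l \<noteq> 0} = {i}" for i by (auto simp: axis_pt_def)
  have supp2: "{l. pair_pt rho (i, j) l \<noteq> 0} = {i, j}" if "(i, j) \<in> set (pairs k)" for i j
    using t[OF that] by (auto simp: pair_pt_def)
  have "inj_on axis_pt {..<k}" using supp by (intro inj_onI) (metis singleton_inject)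
  moreover have "inj_on (pair_pt rho) (set (pairs k))"
  proof (rule inj_onI)
    fix p p' assume p: "p \<in> set (pairs k)" "p' \<in> set (pairs k)" "pair_pt rho p = pair_pt rho p'"
    obtain i j i' j' where e: "p = (i, j)" "p' = (i', j')" by (metis surj_pair)
    then have "{i, j} = {i', j'}" using p supp2 by metis
    then show "p = p'" using p(1,2) unfolding e by (auto simp: set_pairs doubleton_eq_iff)
  qed
  moreover have "axis_pt ` {..<k} \<inter> pair_pt rho ` set (pairs k) = {}"
  proof -
    have "axis_pt l \<noteq> pair_pt rho (i, j)" if "(i, j) \<in> set (pairs k)" for l i j
    proof
      assume "axis_pt l = pair_pt rho (i, j)"
      then have "{i, j} = {l}" using supp[of l] supp2[OF that] by simp
      then show False using that by (auto simp: set_pairs doubleton_eq_iff)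
    qed
    then show ?thesis by auto
  qed
  moreover have "(\<lambda>_. 0) \<notin> axis_pt ` {..<k} \<union> pair_pt rho ` set (pairs k)"
  proof -
    have "(\<lambda>_. 0) \<noteq> axis_pt l" for l by (auto simp: axis_pt_def fun_eq_iff)
    moreover have "(\<lambda>_. 0) \<noteq> pair_pt rho (i, j)" if "(i, j) \<in> set (pairs k)" for i j
      using fun_cong[of "\<lambda>_. 0" "pair_pt rho (i, j)" i] t[OF that] by (auto simp: pair_pt_def)
    ultimately show ?thesis by auto
  qed
  ultimately show ?thesis
    by (simp add: opt_support_eq card_Un_disjoint card_image card_pairs npar_def)
qed

text \<open>On the face every regression entry is 0 or one of \<open>1\<close>, \<open>x i\<close>,
  \<open>x j\<close>, \<open>x i * x j\<close>. The four coefficients are the Lagrange basis of the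
  span of these monomials: each is 1 at its own node and 0 at the other three.\<close>

lemma regf_interpolation:
  assumes ij: "i < j" "j < k" and x: "x \<in> Xij i j" and t: "tval (rho i j) \<noteq> 0" and a: "a < npar k"
  defines "t \<equiv> tval (rho i j)"
  shows "regf k x ! a = (1 - x i / 2 - x j / 2 + (t - 1) * (x i * x j / t\<^sup>2)) * (regf k (\<lambda>_. 0) ! a)
    + x i / 2 * (1 - x j / t) * (regf k (axis_pt i) ! a)
    + x j / 2 * (1 - x i / t) * (regf k (axis_pt j) ! a)
    + x i * x j / t\<^sup>2 * (regf k (pair_pt rho (i, j)) ! a)"
proof -
  have x0: "x l = 0" if "l \<noteq> i" "l \<noteq> j" for l using x that by (auto simp: Xij_def)
  have t0: "t \<noteq> 0" using t by (simp add: t_def)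
  from a show ?thesis
  proof (cases rule: regf_nth_cases)
    case const
    then show ?thesis using t0 by (simp add: field_simps power2_eq_square)
  next
    case (linear l)
    consider "l = i" | "l = j" | "l \<noteq> i" "l \<noteq> j" by blast
    then show ?thesis
      by cases (use ij t0 in \<open>auto simp: linear axis_pt_def pair_pt_def t_def[symmetric] x0
        field_simps power2_eq_square\<close>)
  next
    case (interaction l m)
    \<comment> \<open>Any other product has a factor that vanishes at \<open>x\<close> and at all
      four nodes.\<close>
    consider "l = i" "m = j" | "l \<notin> {i, j} \<or> m \<notin> {i, j}" using interaction(1) ij by fastforce
    then show ?thesis
      by cases (use interaction(1) ij t0 in \<open>auto simp: interaction(3) axis_pt_def pair_pt_def
        t_def[symmetric] x0 power2_eq_square\<close>)
  qed
qed

text \<open>The interpolation coefficients are rescaled by the ratios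
  \<open>sqrt (\<mu> x) / sqrt (\<mu> y)\<close>. The squared norm becomes \<open>\<mu> x\<close>
  times the left side of \<open>sensitivity_bound\<close>, whose right side is
  \<open>1 / \<mu> x\<close>.\<close>

lemma weighted_regf_in_unit_ball:
  assumes rho: "\<And>i j. i < j \<Longrightarrow> j < k \<Longrightarrow> rho i j \<ge> 0" and "x \<in> Xreg k"
  defines "\<mu> \<equiv> intensity k (beta_of k rho)" and "T \<equiv> opt_support k rho"
  shows "\<exists>h. (\<forall>a<npar k. sqrt (\<mu> x) * (regf k x ! a) = (\<Sum>y\<in>T. h y * (sqrt (\<mu> y) * (regf k y ! a))))
    \<and> (\<Sum>y\<in>T. (h y)\<^sup>2) \<le> 1"
proof -
  obtain i j where ij: "i < j" "j < k" and x: "x \<in> Xij i j"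
    using assms(2) by (auto simp: Xreg_iff)
  define t where "t = tval (rho i j)"
  note t = tval[OF rho[OF ij], folded t_def]
  define c0 where "c0 = 1 - x i / 2 - x j / 2 + (t - 1) * (x i * x j / t\<^sup>2)"
  define c1 where "c1 = x i / 2 * (1 - x j / t)"
  define c2 where "c2 = x j / 2 * (1 - x i / t)"
  define c3 where "c3 = x i * x j / t\<^sup>2"
  define P0 :: "nat \<Rightarrow> real" where "P0 = (\<lambda>_. 0)"
  define P1 where "P1 = axis_pt i"
  define P2 where "P2 = axis_pt j"
  define P3 where "P3 = pair_pt rho (i, j)"
  note P = P0_def P1_def P2_def P3_def axis_pt_def pair_pt_def
  have at: "P0 i = 0" "P0 j = 0" "P1 i = 2" "P1 j = 0" "P2 i = 0" "P2 j = 2" "P3 i = t" "P3 j = t"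
    using ij by (auto simp: P t_def)
  then have distinct: "P0 \<noteq> P1" "P0 \<noteq> P2" "P0 \<noteq> P3" "P1 \<noteq> P2" "P1 \<noteq> P3" "P2 \<noteq> P3"
    using t(1) by (metis zero_neq_numeral less_irrefl)+
  have T: "finite T" by (simp add: T_def finite_opt_support)
  have P_T: "{P0, P1, P2, P3} \<subseteq> T"
    using ij by (auto simp: T_def opt_support_eq P0_def P1_def P2_def P3_def set_pairs)
  have mem: "P0 \<in> Xij i j" "P1 \<in> Xij i j" "P2 \<in> Xij i j" "P3 \<in> Xij i j"
    using t(1) by (auto simp: Xij_def P t_def)
  have lam: "\<mu> y = exp (- (y i + y j + rho i j * (y i * y j)))" if "y \<in> Xij i j" for y
    unfolding \<mu>_def by (rule intensity_Xij[OF ij that])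
  \<comment> \<open>At \<open>P3\<close> the sum \<open>2 * t + rho i j * t\<^sup>2\<close> equals
    \<open>t + 2\<close> by the equation for \<open>t\<close>.\<close>
  have lamP: "\<mu> P0 = 1" "\<mu> P1 = exp (- 2)" "\<mu> P2 = exp (- 2)" "\<mu> P3 = exp (- (t + 2))"
    using t(3) by (simp_all add: lam mem at power2_eq_square)
  have pos: "0 < \<mu> y" for y by (simp add: \<mu>_def intensity_def)
  define c where "c y = (if y = P0 then c0 else if y = P1 then c1 else if y = P2 then c2
    else if y = P3 then c3 else 0)" for y
  have cP: "c P0 = c0" "c P1 = c1" "c P2 = c2" "c P3 = c3"
    using distinct by (auto simp: c_def)
  have sum: "(\<Sum>y\<in>T. c y * \<psi> y) = c0 * \<psi> P0 + c1 * \<psi> P1 + c2 * \<psi> P2 + c3 * \<psi> P3" for \<psi>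
  proof -
    have "(\<Sum>y\<in>T. c y * \<psi> y) = (\<Sum>y\<in>{P0, P1, P2, P3}. c y * \<psi> y)"
      using T P_T by (intro sum.mono_neutral_right) (auto simp: c_def)
    then show ?thesis using distinct by (simp add: cP)
  qed
  define h where "h y = sqrt (\<mu> x) / sqrt (\<mu> y) * c y" for y
  have "sqrt (\<mu> x) * (regf k x ! a) = (\<Sum>y\<in>T. h y * (sqrt (\<mu> y) * (regf k y ! a)))"
    if a: "a < npar k" for a
  proof -
    have "(\<Sum>y\<in>T. h y * (sqrt (\<mu> y) * (regf k y ! a))) = (\<Sum>y\<in>T. sqrt (\<mu> x) * (c y * (regf k y ! a)))"
      using pos by (intro sum.cong) (auto simp: h_def less_imp_neq[symmetric])
    also have "\<dots> = sqrt (\<mu> x) * (\<Sum>y\<in>T. c y * (regf k y ! a))" by (simp add: sum_distrib_left)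
    also have "(\<Sum>y\<in>T. c y * (regf k y ! a)) = regf k x ! a"
      unfolding sum using regf_interpolation[OF ij x _ a, of rho] t(1)
      by (simp add: c0_def c1_def c2_def c3_def P0_def P1_def P2_def P3_def t_def)
    finally show ?thesis by simp
  qed
  moreover have "(\<Sum>y\<in>T. (h y)\<^sup>2) \<le> 1"
  proof -
    have "(\<Sum>y\<in>T. (h y)\<^sup>2) = (\<Sum>y\<in>T. \<mu> x * (c y * (c y / \<mu> y)))"
      using pos by (intro sum.cong) (auto simp: h_def power_mult_distrib power_divide power2_eq_square less_imp_le)
    also have "\<dots> = \<mu> x * (\<Sum>y\<in>T. c y * (c y / \<mu> y))" by (simp add: sum_distrib_left)
    also have "(\<Sum>y\<in>T. c y * (c y / \<mu> y)) = c0\<^sup>2 + exp 2 * (c1\<^sup>2 + c2\<^sup>2) + exp (t + 2) * c3\<^sup>2"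
    proof -
      have "d * (d / exp (- v)) = exp v * d\<^sup>2" for d v :: real
        by (simp add: exp_minus power2_eq_square field_simps)
      then show ?thesis unfolding sum lamP cP by (simp only: power2_eq_square distrib_left)
    qed
    also have "\<dots> \<le> exp (x i + x j + (2 - t) / t\<^sup>2 * (x i * x j))"
      unfolding c0_def c1_def c2_def c3_def
      using x by (intro sensitivity_bound[OF t(1,2)]) (auto simp: Xij_def)
    also have "(2 - t) / t\<^sup>2 = rho i j" using t by (simp add: field_simps)
    finally have "(\<Sum>y\<in>T. (h y)\<^sup>2) \<le> \<mu> x * exp (x i + x j + rho i j * (x i * x j))"
      using pos[of x] by simp
    also have "\<dots> = 1" by (simp add: lam[OF x] flip: exp_add)
    finally show ?thesis .
  qed
  ultimately show ?thesis by blast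
qed

section \<open>Optimality of the equally weighted design\<close>

theorem theorem7:
  fixes k :: nat and rho :: "nat \<Rightarrow> nat \<Rightarrow> real"
  assumes "k \<ge> 3"
    and "\<And>i j. i < j \<Longrightarrow> j < k \<Longrightarrow> rho i j \<ge> 0"
  shows "locally_D_optimal k (beta_of k rho) (Xreg k) (opt_support k rho)
           (\<lambda>_. 1 / real (1 + k + k * (k - 1) div 2))"
proof -
  let ?T = "opt_support k rho" and ?n = "npar k" and ?b = "beta_of k rho"
  \<comment> \<open>Absorbing the root of the intensity makes the information matrix a weighted Gram
    matrix of the vectors \<open>F x\<close>.\<close>
  define F where "F x a = sqrt (intensity k ?b x) * (regf k x ! a)" for x a
  have n: "1 + k + k * (k - 1) div 2 = ?n" by (simp add: npar_def length_pairs)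
  have card: "card ?T = ?n" using assms(2) by (rule card_opt_support)
  have info: "info_mat k ?b S w = mat ?n ?n (\<lambda>(a, b). \<Sum>x\<in>S. w x * F x a * F x b)" for S w
  proof -
    have "sqrt (intensity k ?b x) * sqrt (intensity k ?b x) = intensity k ?b x" for x
      by (simp add: intensity_def)
    then have "w x * intensity k ?b x * (regf k x ! a) * (regf k x ! b) = w x * F x a * F x b" for x a b
      by (metis (no_types, opaque_lifting) F_def mult.assoc mult.commute)
    then show ?thesis unfolding info_mat_def by (simp only:)
  qed
  have "?T \<subseteq> Xreg k"
  proof
    fix x assume "x \<in> ?T"
    then consider "x = (\<lambda>_. 0)" | l where "l < k" "x = axis_pt l"
      | i j where "i < j" "j < k" "x = pair_pt rho (i, j)"
      by (auto simp: opt_support_eq set_pairs)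
    then show "x \<in> Xreg k"
    proof cases
      case 1
      then have "x \<in> Xij 0 1" by (simp add: Xij_def)
      then show ?thesis using assms(1) unfolding Xreg_iff by (intro exI[of _ 0] exI[of _ 1]) simp
    next
      case (2 l)
      \<comment> \<open>The face \<open>Xij 0 m\<close> contains the axis of \<open>l\<close>; for
        \<open>l = 0\<close> a second index is needed, and 1 is taken.\<close>
      define m where "m = (if l = 0 then 1 else l)"
      have "x \<in> Xij 0 m" using 2 by (auto simp: Xij_def axis_pt_def m_def)
      moreover have "0 < m" "m < k" using assms(1) 2(1) by (auto simp: m_def)
      ultimately show ?thesis unfolding Xreg_iff by blast
    next
      case (3 i j)
      then have "x \<in> Xij i j"
        using tval(1)[OF assms(2)[OF 3(1,2)]] by (auto simp: Xij_def pair_pt_def)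
      with 3(1,2) show ?thesis unfolding Xreg_iff by blast
    qed
  qed
  then have design: "is_design (Xreg k) ?T (\<lambda>_. 1 / real (1 + k + k * (k - 1) div 2))"
    unfolding is_design_def n by (simp add: finite_opt_support card) (auto simp: npar_def opt_support_eq)
  have "det (info_mat k ?b S w) \<le> det (info_mat k ?b ?T (\<lambda>_. 1 / real ?n))"
    if "is_design (Xreg k) S w" for S w
  proof -
    have "\<forall>x\<in>S. \<exists>h. (\<forall>a<?n. F x a = (\<Sum>y\<in>?T. h y * F y a)) \<and> (\<Sum>y\<in>?T. (h y)\<^sup>2) \<le> 1"
    proof
      fix x assume "x \<in> S"
      then have "x \<in> Xreg k" using that by (auto simp: is_design_def)
      with assms(2) show "\<exists>h. (\<forall>a<?n. F x a = (\<Sum>y\<in>?T. h y * F y a)) \<and> (\<Sum>y\<in>?T. (h y)\<^sup>2) \<le> 1"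
        unfolding F_def by (rule weighted_regf_in_unit_ball)
    qed
    then obtain h where h: "\<And>x a. x \<in> S \<Longrightarrow> a < ?n \<Longrightarrow> F x a = (\<Sum>y\<in>?T. h x y * F y a)"
      "\<And>x. x \<in> S \<Longrightarrow> (\<Sum>y\<in>?T. (h x y)\<^sup>2) \<le> 1"
      by metis
    \<comment> \<open>Numbering the support points by the parameter indices makes the matrix of
      their \<open>F\<close> vectors square, as \<open>det_gram_le\<close> requires.\<close>
    obtain p where p: "bij_betw p {..<?n} ?T"
      using ex_bij_betw_nat_finite[OF finite_opt_support, of k rho] by (auto simp: card lessThan_atLeast0)
    note reindex = sum.reindex_bij_betw[OF p, symmetric]
    show ?thesis
      unfolding info reindex
      by (rule det_gram_le[where h = "\<lambda>x s. h x (p s)"])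
        (use that h in \<open>auto simp: is_design_def reindex\<close>)
  qed
  with design show ?thesis unfolding locally_D_optimal_def n by blast
qed

end
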